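(* Let $k\in\{0,\ldots,n-1\}$ and let $(N_k,Z_k)$ be a pair of $\mathcal F_k$-measurable random variables. Then $V_k(N_k,Z_k)$ equals the essential infimum of all $\mathbb E^{\mathbb Q}[M|\mathcal F_k]$, $M\in\mathcal F_{k+1}$, such that there exists a random variable $N\in\mathcal F_{k+1}$ satisfying $$\begin{cases} \mathbb E^{\mathbb P}[N|\mathcal F_k]=N_k,\\ M\geq V_{k+1}\big(N,\max(Z_k,\,l(M-S_{k+1})-\alpha_{k+1})\big). \end{cases}$$
   Context: Setting: $(\Omega,\mathcal F,\mathbb P)$ is a probability space with a discrete filtration $\mathbb F=(\mathcal F_k)_{k=0}^n$, $n\ge 1$, with $\mathcal F_0$ trivial; $\mathbb Q$ is a probability measure equivalent to $\mathbb P$; $S_0=0$ and $S_k=P_1+\dots+P_k$, where each $P_i$ is $\mathcal F_i$-measurable with $\mathbb E^{\mathbb Q}[|P_i|]<\infty$. The loss function $l:\mathbf R\to\mathbf R$ is convex, decreasing (in the weak sense) and bounded from below; $\alpha_1,\ldots,\alpha_n$ are real numbers. All supermartingales are with respect to $\mathbb F$. The notation $M\in\mathcal F_k$ means that $M$ is an $\mathcal F_k$-measurable random variable. Value function (lookback-style constraint): for $k\in\{0,\ldots,n-1\}$ and a pair $(N_k,Z_k)$ of $\mathcal F_k$-measurable random variables (the value $Z_k=-\infty$ being allowed), $V_k(N_k,Z_k)$ is the essential infimum of all $M_k\in\mathcal F_k$ such that there exist a $\mathbb Q$-supermartingale $(M_t)_{t=k}^n$ (starting from this $M_k$) and a $\mathbb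 P$-supermartingale $(N_t)_{t=k}^n$ (starting from the given $N_k$) verifying $$\max\big\{Z_k,\max_{t\in\{k+1,\ldots,n\}}\{l(M_t-S_t)-\alpha_t\}\big\}\leq N_n.$$ By convention, $V_n(N_n,Z_n)=+\infty$ on $\{Z_n>N_n\}$ and $V_n(N_n,Z_n)=-\infty$ on $\{Z_n\leq N_n\}$. *)

theory Defs
  imports "HOL-Probability.Probability"
begin

text \<open>A family \<open>X\<close> indexed by the times \<open>k, \<dots>, n\<close>; values outside this range are irrelevant.\<close>

definition supermartingale ::
  "'a measure \<Rightarrow> (nat \<Rightarrow> 'a measure) \<Rightarrow> nat \<Rightarrow> nat \<Rightarrow> (nat \<Rightarrow> 'a \<Rightarrow> real) \<Rightarrow> bool" where
  "supermartingale M F k n X \<longleftrightarrow>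
     (\<forall>t\<in>{k..n}. X t \<in> borel_measurable (F t) \<and> integrable M (X t)) \<and>
     (\<forall>s\<in>{k..n}. \<forall>t\<in>{s..n}. AE x in M. real_cond_exp M (F s) (X t) x \<le> X s x)"

text \<open>The essential infimum of a family of random variables is the almost surely largest
  extended-real random variable lying almost surely below every member of the family. It is
  determined up to null sets only, so \<open>ess_inf\<close> is one chosen version; existence and
  uniqueness are proved below. The essential infimum of the empty family is \<open>\<infinity>\<close>.\<close>

definition is_ess_inf :: "'a measure \<Rightarrow> ('a \<Rightarrow> ereal) set \<Rightarrow> ('a \<Rightarrow> ereal) \<Rightarrow> bool" where
  "is_ess_inf M \<Phi> X \<longleftrightarrow>
     X \<in> borel_measurable M \<and>
     (\<forall>\<phi>\<in>\<Phi>. AE x in M. X x \<le> \<phi> x) \<and>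
     (\<forall>Y\<in>borel_measurable M. (\<forall>\<phi>\<in>\<Phi>. AE x in M. Y x \<le> \<phi> x) \<longrightarrow> (AE x in M. Y x \<le> X x))"

definition ess_inf :: "'a measure \<Rightarrow> ('a \<Rightarrow> ereal) set \<Rightarrow> 'a \<Rightarrow> ereal" where
  "ess_inf M \<Phi> = (SOME X. is_ess_inf M \<Phi> X)"

lemma is_ess_inf_unique:
  assumes "is_ess_inf M \<Phi> X" "is_ess_inf M \<Phi> Y"
  shows "AE x in M. X x = Y x"
proof -
  have "AE x in M. X x \<le> Y x" "AE x in M. Y x \<le> X x"
    using assms unfolding is_ess_inf_def by auto
  then show ?thesis by eventually_elim auto
qed

lemma (in finite_measure) maximal_countable_Union:
  assumes E: "\<And>\<phi>. \<phi> \<in> \<Phi> \<Longrightarrow> E \<phi> \<in> sets M"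
  shows "\<exists>C. countable C \<and> C \<subseteq> \<Phi> \<and> (\<forall>\<phi>\<in>\<Phi>. E \<phi> - (\<Union>\<psi>\<in>C. E \<psi>) \<in> null_sets M)"
proof -
  define T where "T = {C. countable C \<and> C \<subseteq> \<Phi>}"
  define m where "m C = measure M (\<Union>\<psi>\<in>C. E \<psi>)" for C
  define s where "s = (SUP C\<in>T. m C)"
  have UnE: "(\<Union>\<psi>\<in>C. E \<psi>) \<in> sets M" if "C \<in> T" for C
    using that E unfolding T_def by (intro sets.countable_UN') auto
  have bdd: "bdd_above (m ` T)"
    unfolding m_def by (rule bdd_aboveI2[where M = "measure M (space M)"]) (rule bounded_measure)
  have ne: "T \<noteq> {}" unfolding T_def by blast
  have "\<exists>C\<in>T. s - 1 / Suc i < m C" for i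
    using less_cSUP_iff[OF ne bdd, of "s - 1 / Suc i"] by (auto simp: s_def)
  then obtain D where D: "\<And>i. D i \<in> T" "\<And>i. s - 1 / Suc i < m (D i)" by metis
  define C where "C = (\<Union>i. D i)"
  have CT: "C \<in> T" using D(1) unfolding C_def T_def by blast
  have up: "m A \<le> s" if "A \<in> T" for A unfolding s_def using that bdd by (rule cSUP_upper)
  have low: "s - 1 / Suc i \<le> m C" for i
  proof -
    have "m (D i) \<le> m C"
      unfolding m_def using UnE[OF CT] UnE[OF D(1)]
      by (intro finite_measure_mono) (auto simp: C_def)
    then show ?thesis using D(2)[of i] by simp
  qed
  have "s \<le> m C"
  proof (rule field_le_epsilon)
    fix e :: real assume "0 < e"
    then obtain i where "1 / Suc i < e" using nat_approx_posE by blast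
    then show "s \<le> m C + e" using low[of i] by linarith
  qed
  moreover have "E \<phi> - (\<Union>\<psi>\<in>C. E \<psi>) \<in> null_sets M" if "\<phi> \<in> \<Phi>" "s \<le> m C" for \<phi>
  proof -
    have iT: "insert \<phi> C \<in> T" using CT that unfolding T_def by auto
    have meas: "E \<phi> - (\<Union>\<psi>\<in>C. E \<psi>) \<in> sets M" using E that UnE[OF CT] by auto
    have "m (insert \<phi> C) = m C + measure M (E \<phi> - (\<Union>\<psi>\<in>C. E \<psi>))"
    proof -
      have "(\<Union>\<psi>\<in>insert \<phi> C. E \<psi>) = (\<Union>\<psi>\<in>C. E \<psi>) \<union> (E \<phi> - (\<Union>\<psi>\<in>C. E \<psi>))" by auto
      then show ?thesis unfolding m_def
        using finite_measure_Union[OF UnE[OF CT] meas] by auto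
    qed
    then have "measure M (E \<phi> - (\<Union>\<psi>\<in>C. E \<psi>)) \<le> 0"
      using up[OF iT] that(2) by linarith
    then show ?thesis using meas
      by (simp add: null_sets_def emeasure_eq_measure measure_le_0_iff)
  qed
  ultimately show ?thesis using CT unfolding T_def by blast
qed

lemma (in finite_measure) is_ess_inf_exists:
  assumes meas: "\<Phi> \<subseteq> borel_measurable M"
  shows "\<exists>X. is_ess_inf M \<Phi> X"
proof -
  define E where "E q \<phi> = {x\<in>space M. \<phi> x < ereal (of_rat q)}" for q and \<phi> :: "'a \<Rightarrow> ereal"
  have Em: "E q \<phi> \<in> sets M" if "\<phi> \<in> \<Phi>" for q \<phi>
  proof -
    have [measurable]: "\<phi> \<in> borel_measurable M" using that meas by blast
    show ?thesis unfolding E_def by measurable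
  qed
  have "\<exists>C. countable C \<and> C \<subseteq> \<Phi> \<and> (\<forall>\<phi>\<in>\<Phi>. E q \<phi> - (\<Union>\<psi>\<in>C. E q \<psi>) \<in> null_sets M)" for q
    by (rule maximal_countable_Union) (rule Em)
  then obtain D where D: "\<And>q. countable (D q)" "\<And>q. D q \<subseteq> \<Phi>"
    "\<And>q \<phi>. \<phi> \<in> \<Phi> \<Longrightarrow> E q \<phi> - (\<Union>\<psi>\<in>D q. E q \<psi>) \<in> null_sets M" by metis
  define C where "C = (\<Union>q. D q)"
  have C: "countable C" "C \<subseteq> \<Phi>" unfolding C_def using D(1,2) by auto
  define X where "X x = (INF \<psi>\<in>C. \<psi> x)" for x
  have "X \<in> borel_measurable M"
    unfolding X_def using C meas by (intro borel_measurable_INF) auto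
  moreover have "AE x in M. X x \<le> \<phi> x" if "\<phi> \<in> \<Phi>" for \<phi>
  proof -
    have "AE x in M. \<forall>q. x \<notin> E q \<phi> - (\<Union>\<psi>\<in>D q. E q \<psi>)"
      unfolding AE_all_countable using AE_not_in[OF D(3)[OF that]] by blast
    then show ?thesis
    proof (rule AE_mp, intro AE_I2 impI)
      fix x assume x: "x \<in> space M" "\<forall>q. x \<notin> E q \<phi> - (\<Union>\<psi>\<in>D q. E q \<psi>)"
      show "X x \<le> \<phi> x"
      proof (rule ccontr)
        assume "\<not> X x \<le> \<phi> x"
        then obtain r where r: "\<phi> x < ereal r" "ereal r < X x"
          using ereal_dense2[of "\<phi> x" "X x"] by (auto simp: not_le)
        then obtain r' where r': "ereal r < ereal r'" "ereal r' < X x"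
          using ereal_dense2[of "ereal r" "X x"] by auto
        obtain q where q: "r < of_rat q" "of_rat q < r'"
          using of_rat_dense[of r r'] r' by auto
        have "x \<in> E q \<phi>" using r q x by (auto simp: E_def intro: less_trans)
        then obtain \<psi> where "\<psi> \<in> D q" "x \<in> E q \<psi>" using x by blast
        then have "X x < ereal (of_rat q)" unfolding X_def C_def E_def INF_less_iff by auto
        then have "X x < ereal r'" using q by (auto intro: less_trans)
        then show False using r' by auto
      qed
    qed
  qed
  moreover have "AE x in M. Y x \<le> X x" if "\<forall>\<phi>\<in>\<Phi>. AE x in M. Y x \<le> \<phi> x" for Y
  proof -
    have "AE x in M. \<forall>\<psi>\<in>C. Y x \<le> \<psi> x"
      using that C by (subst AE_ball_countable) auto
    then show ?thesis unfolding X_def by eventually_elim (auto intro: INF_greatest)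
  qed
  ultimately show ?thesis unfolding is_ess_inf_def by blast
qed

lemma (in finite_measure) is_ess_inf_ess_inf:
  assumes "\<Phi> \<subseteq> borel_measurable M"
  shows "is_ess_inf M \<Phi> (ess_inf M \<Phi>)"
  unfolding ess_inf_def using is_ess_inf_exists[OF assms] by (rule someI_ex)

definition partial_sum :: "(nat \<Rightarrow> 'a \<Rightarrow> real) \<Rightarrow> nat \<Rightarrow> 'a \<Rightarrow> real" where
  "partial_sum p k x = (\<Sum>i = 1..k. p i x)"

text \<open>The initial values \<open>m\<close> of \<open>Q\<close>-supermartingales admissible for the pair \<open>(Nk, Zk)\<close>;
  meant for \<open>k < n\<close>, so that the maximum over \<open>t\<close> is over a nonempty set.\<close>

definition admissible ::
  "'a measure \<Rightarrow> 'a measure \<Rightarrow> (nat \<Rightarrow> 'a measure) \<Rightarrow> nat \<Rightarrow> (real \<Rightarrow> real) \<Rightarrow> (nat \<Rightarrow> real) \<Rightarrow>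
   (nat \<Rightarrow> 'a \<Rightarrow> real) \<Rightarrow> nat \<Rightarrow> ('a \<Rightarrow> real) \<Rightarrow> ('a \<Rightarrow> ereal) \<Rightarrow> ('a \<Rightarrow> real) set" where
  "admissible P Q F n l \<alpha> S k Nk Zk =
     {m \<in> borel_measurable (F k).
        \<exists>M N. supermartingale Q F k n M \<and> M k = m \<and>
              supermartingale P F k n N \<and> N k = Nk \<and>
              (AE x in P. max (Zk x) (ereal (MAX t\<in>{k+1..n}. l (M t x - S t x) - \<alpha> t))
                            \<le> ereal (N n x))}"

definition value_function ::
  "'a measure \<Rightarrow> 'a measure \<Rightarrow> (nat \<Rightarrow> 'a measure) \<Rightarrow> nat \<Rightarrow> (real \<Rightarrow> real) \<Rightarrow> (nat \<Rightarrow> real) \<Rightarrow>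
   (nat \<Rightarrow> 'a \<Rightarrow> real) \<Rightarrow> nat \<Rightarrow> ('a \<Rightarrow> real) \<Rightarrow> ('a \<Rightarrow> ereal) \<Rightarrow> 'a \<Rightarrow> ereal" where
  "value_function P Q F n l \<alpha> S k Nk Zk =
     (if k = n then (\<lambda>x. if Zk x > ereal (Nk x) then \<infinity> else -\<infinity>)
      else ess_inf P {\<lambda>x. ereal (m x) | m. m \<in> admissible P Q F n l \<alpha> S k Nk Zk})"

end

theory Submission
  imports Defs
begin

text \<open>Given an admissible pair of processes from time \<open>k\<close> on, the value at time \<open>k + 1\<close> of the first,
  and that of the second raised to have conditional expectation exactly \<open>N\<^sub>k\<close>, satisfy the one-step
  condition. Conversely, let \<open>(M, N)\<close> satisfy the one-step condition. The admissible starting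
  values at time \<open>k + 1\<close> for \<open>N\<close> can be glued along \<open>F\<^bsub>k+1\<^esub>\<close>-measurable sets, so there is a sequence
  \<open>m\<^sub>j\<close> of them, bounded above by the first of them, that eventually falls below \<open>M + \<epsilon>\<close>. Since \<open>l\<close> is decreasing, the processes of
  \<open>m\<^sub>j\<close>, restarted at time \<open>k + 1\<close> from \<open>max m\<^sub>j M\<close>, are admissible at time \<open>k\<close> with
  initial value \<open>E\<^sup>Q[max m\<^sub>j M | F\<^sub>k]\<close>, and by dominated convergence these values come
  arbitrarily close to \<open>E\<^sup>Q[M | F\<^sub>k] + \<epsilon>\<close>.\<close>

section \<open>Conditional expectations of a sequence tending to zero in mean\<close>

text \<open>The pointwise infimum over \<open>j\<close> of the conditional expectations has integral
  at most the mean of each \<open>Y j\<close>, hence integral zero, hence vanishes almost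
  everywhere. The index \<open>j\<close> may depend on \<open>x\<close>, so no almost surely
  convergent subsequence has to be extracted.\<close>

lemma (in sigma_finite_subalgebra) AE_real_cond_exp_arbitrarily_small:
  fixes Y :: "nat \<Rightarrow> 'a \<Rightarrow> real"
  assumes int: "\<And>j. integrable M (Y j)"
    and nonneg: "\<And>j. AE x in M. 0 \<le> Y j x"
    and lim: "(\<lambda>j. \<integral>x. Y j x \<partial>M) \<longlonglongrightarrow> 0"
  shows "AE x in M. \<forall>e>0. \<exists>j. real_cond_exp M F (Y j) x < e"
proof -
  \<comment> \<open>With values in \<open>ennreal\<close> the infimum always exists and can be
    integrated without an integrability condition.\<close>
  define G where "G x = (INF j. ennreal (real_cond_exp M F (Y j) x))" for x
  have G [measurable]: "G \<in> borel_measurable M"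
    unfolding G_def by measurable
  have "(\<integral>\<^sup>+x. G x \<partial>M) \<le> ennreal (\<integral>x. Y j x \<partial>M)" for j
  proof -
    have pos: "AE x in M. 0 \<le> real_cond_exp M F (Y j) x"
      using nonneg int by (intro real_cond_exp_pos) auto
    have "(\<integral>\<^sup>+x. G x \<partial>M) \<le> (\<integral>\<^sup>+x. ennreal (real_cond_exp M F (Y j) x) \<partial>M)"
      unfolding G_def by (intro nn_integral_mono INF_lower) simp
    also have "\<dots> = ennreal (\<integral>x. Y j x \<partial>M)"
      using nn_integral_eq_integral[OF real_cond_exp_int(1)[OF int] pos]
        real_cond_exp_int(2)[OF int] by simp
    finally show ?thesis .
  qed
  moreover have "(\<lambda>j. ennreal (\<integral>x. Y j x \<partial>M)) \<longlonglongrightarrow> 0"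
    using tendsto_ennrealI[OF lim] by simp
  ultimately have "(\<integral>\<^sup>+x. G x \<partial>M) \<le> 0"
    by (intro LIMSEQ_le_const) auto
  then have "AE x in M. G x = 0"
    using nn_integral_0_iff_AE[OF G] by simp
  then show ?thesis
  proof eventually_elim
    case (elim x)
    show ?case
    proof (intro allI impI)
      fix e :: real assume "e > 0"
      then have "G x < ennreal e" using elim by simp
      then obtain j where "ennreal (real_cond_exp M F (Y j) x) < ennreal e"
        unfolding G_def INF_less_iff by auto
      \<comment> \<open>\<open>ennreal\<close> sends negative reals to \<open>0\<close>; since
        \<open>e > 0\<close>, the strict inequality still holds between the real numbers.\<close>
      then show "\<exists>j. real_cond_exp M F (Y j) x < e"
        using \<open>e > 0\<close> by (metis ennreal_leI not_le)
    qed
  qed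
qed

section \<open>Essential infima and their approximation by sequences\<close>

lemma is_ess_inf_lower:
  "is_ess_inf M \<Phi> X \<Longrightarrow> \<phi> \<in> \<Phi> \<Longrightarrow> AE x in M. X x \<le> \<phi> x"
  by (simp add: is_ess_inf_def)

lemma is_ess_inf_greatest:
  "is_ess_inf M \<Phi> X \<Longrightarrow> Y \<in> borel_measurable M \<Longrightarrow> (\<And>\<phi>. \<phi> \<in> \<Phi> \<Longrightarrow> AE x in M. Y x \<le> \<phi> x) \<Longrightarrow>
    AE x in M. Y x \<le> X x"
  by (simp add: is_ess_inf_def)

lemma is_ess_inf_measurable: "is_ess_inf M \<Phi> X \<Longrightarrow> X \<in> borel_measurable M"
  by (simp add: is_ess_inf_def)

text \<open>Exhaustion: a countable subfamily \<open>C\<close> is chosen so that the union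
  \<open>B\<close> of its sets \<open>E \<psi>\<close> contains every \<open>E \<phi>\<close> up to
  a null set. If \<open>B\<close> missed a set of positive measure, then \<open>U\<close> on that
  set would improve the greatest lower bound. An enumeration of \<open>C\<close> is the required
  sequence.\<close>

lemma (in finite_measure) ess_inf_approx:
  assumes meas: "\<Phi> \<subseteq> borel_measurable M" and ne: "\<Phi> \<noteq> {}"
    and [measurable]: "U \<in> borel_measurable M"
    and less: "AE x in M. ess_inf M \<Phi> x < U x"
  shows "\<exists>\<phi>. range \<phi> \<subseteq> \<Phi> \<and> (AE x in M. \<exists>j::nat. \<phi> j x \<le> U x)"
proof -
  have inf: "is_ess_inf M \<Phi> (ess_inf M \<Phi>)"
    using meas by (rule is_ess_inf_ess_inf)
  define E where "E \<phi> = {x\<in>space M. \<phi> x \<le> U x}" for \<phi> :: "'a \<Rightarrow> ereal"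
  have Em: "E \<phi> \<in> sets M" if "\<phi> \<in> \<Phi>" for \<phi>
  proof -
    have [measurable]: "\<phi> \<in> borel_measurable M" using that meas by blast
    show ?thesis unfolding E_def by measurable
  qed
  obtain C where C: "countable C" "C \<subseteq> \<Phi>"
    "\<And>\<phi>. \<phi> \<in> \<Phi> \<Longrightarrow> E \<phi> - (\<Union>\<psi>\<in>C. E \<psi>) \<in> null_sets M"
    using maximal_countable_Union[of \<Phi> E] Em by blast
  define B where "B = (\<Union>\<psi>\<in>C. E \<psi>)"
  have [measurable]: "B \<in> sets M"
    unfolding B_def using C Em by (intro sets.countable_UN') auto
  \<comment> \<open>Off \<open>B\<close> almost every point lies outside \<open>E \<phi>\<close>, so
    \<open>U\<close> is a lower bound there; on \<open>B\<close> the value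
    \<open>-\<infinity>\<close> makes the bound trivial.\<close>
  define Y where "Y x = (if x \<in> B then -\<infinity> else U x)" for x
  have "Y \<in> borel_measurable M" unfolding Y_def by measurable
  moreover have "AE x in M. Y x \<le> \<phi> x" if "\<phi> \<in> \<Phi>" for \<phi>
    using AE_not_in[OF C(3)[OF that]] AE_space
    by eventually_elim (auto simp: Y_def B_def E_def)
  ultimately have "AE x in M. Y x \<le> ess_inf M \<Phi> x"
    using inf unfolding is_ess_inf_def by blast
  then have B: "AE x in M. x \<in> B"
    using less by eventually_elim (auto simp: Y_def split: if_splits)
  show ?thesis
  proof (cases "C = {}")
    case True
    \<comment> \<open>An empty \<open>C\<close> has no enumeration, but then the measure is zero and
      any constant sequence from the family will do.\<close>
    then have "AE x in M. False" using B by (simp add: B_def)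
    moreover obtain \<phi> where "\<phi> \<in> \<Phi>" using ne by blast
    ultimately show ?thesis by (intro exI[of _ "\<lambda>_. \<phi>"]) auto
  next
    case False
    have "AE x in M. \<exists>j. from_nat_into C j x \<le> U x"
      using B by eventually_elim
        (auto simp: B_def E_def intro: from_nat_into_to_nat_on[OF C(1), symmetric]
          dest!: from_nat_into_surj[OF C(1)])
    moreover have "range (from_nat_into C) \<subseteq> \<Phi>"
      using range_from_nat_into[OF False C(1)] C(2) by simp
    ultimately show ?thesis by blast
  qed
qed

section \<open>Gluing, extending and shifting supermartingales\<close>

lemma integrable_if_mem:
  fixes f g :: "'a \<Rightarrow> real"
  assumes "integrable M f" "integrable M g" "A \<in> sets M"
  shows "integrable M (\<lambda>x. if x \<in> A then f x else g x)"
proof -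
  have "integrable M (\<lambda>x. indicator A x * (f x - g x) + g x)"
    using integrable_mult_indicator[OF assms(3) Bochner_Integration.integrable_diff[OF assms(1,2)]] assms(2)
    by simp
  moreover have "(\<lambda>x. if x \<in> A then f x else g x) = (\<lambda>x. indicator A x * (f x - g x) + g x)"
    by (auto simp: indicator_def)
  ultimately show ?thesis by simp
qed

locale prob_filtration = prob_space M for M :: "'a measure" +
  fixes F :: "nat \<Rightarrow> 'a measure" and n :: nat
  assumes subalg: "i \<le> n \<Longrightarrow> subalgebra M (F i)"
    and filtration: "i \<le> j \<Longrightarrow> j \<le> n \<Longrightarrow> subalgebra (F j) (F i)"
begin

lemma sigma_finite_subalgebra_F: "i \<le> n \<Longrightarrow> sigma_finite_subalgebra M (F i)"
  by (rule finite_measure_subalgebra_is_sigma_finite)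
    (simp add: finite_measure_subalgebra_def finite_measure_subalgebra_axioms_def subalg
      finite_measure_axioms)

lemma measurable_M: "i \<le> n \<Longrightarrow> X \<in> borel_measurable (F i) \<Longrightarrow> X \<in> borel_measurable M"
  using measurable_from_subalg[OF subalg] .

lemma measurable_later:
  "i \<le> j \<Longrightarrow> j \<le> n \<Longrightarrow> X \<in> borel_measurable (F i) \<Longrightarrow> X \<in> borel_measurable (F j)"
  using measurable_from_subalg[OF filtration] .

lemma space_F: "i \<le> n \<Longrightarrow> space (F i) = space M"
  using subalg by (simp add: subalgebra_def)

text \<open>\<open>A\<close> belongs to every \<open>F s\<close> with \<open>s\<close> from
  \<open>k\<close> to \<open>n\<close>, so the indicators of \<open>A\<close> and of its complement
  can be pulled out of each conditional expectation.\<close>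

lemma supermartingale_glue:
  assumes X: "supermartingale M F k n X" and Y: "supermartingale M F k n Y"
    and A: "A \<in> sets (F k)"
  shows "supermartingale M F k n (\<lambda>t x. if x \<in> A then X t x else Y t x)"
  unfolding supermartingale_def
proof (intro conjI ballI)
  fix t assume t: "t \<in> {k..n}"
  have AF: "A \<in> sets (F t)" and AM: "A \<in> sets M"
    using filtration[of k t] subalg[of t] A t by (auto simp: subalgebra_def)
  have XY: "X t \<in> borel_measurable (F t)" "Y t \<in> borel_measurable (F t)"
    "integrable M (X t)" "integrable M (Y t)"
    using X Y t by (auto simp: supermartingale_def)
  show "(\<lambda>x. if x \<in> A then X t x else Y t x) \<in> borel_measurable (F t)"
    using XY AF by measurable
  show "integrable M (\<lambda>x. if x \<in> A then X t x else Y t x)"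
    using XY(3,4) AM by (rule integrable_if_mem)
next
  fix s t assume s: "s \<in> {k..n}" and t: "t \<in> {s..n}"
  interpret sub: sigma_finite_subalgebra M "F s"
    using s sigma_finite_subalgebra_F by simp
  have AF [measurable]: "A \<in> sets (F s)" and AM [measurable]: "A \<in> sets M"
    using filtration[of k s] subalg[of s] A s by (auto simp: subalgebra_def)
  have XY [measurable]: "integrable M (X t)" "integrable M (Y t)"
    using X Y s t by (auto simp: supermartingale_def)
  have le: "AE x in M. real_cond_exp M (F s) (X t) x \<le> X s x"
    "AE x in M. real_cond_exp M (F s) (Y t) x \<le> Y s x"
    using X Y s t by (auto simp: supermartingale_def)
  let ?a = "indicator A :: 'a \<Rightarrow> real" and ?b = "\<lambda>x. 1 - indicator A x :: real"
  have iX: "integrable M (\<lambda>x. ?a x * X t x)"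
    using integrable_mult_indicator[OF AM XY(1)] by simp
  have iY: "integrable M (\<lambda>x. ?b x * Y t x)"
    using integrable_mult_indicator[OF AM XY(2)] XY(2) by (simp add: left_diff_distrib)
  have eq: "(\<lambda>x. if x \<in> A then X t x else Y t x) = (\<lambda>x. ?a x * X t x + ?b x * Y t x)"
    by (auto simp: indicator_def)
  have "AE x in M. real_cond_exp M (F s) (\<lambda>x. ?a x * X t x) x = ?a x * real_cond_exp M (F s) (X t) x"
    "AE x in M. real_cond_exp M (F s) (\<lambda>x. ?b x * Y t x) x = ?b x * real_cond_exp M (F s) (Y t) x"
    using iX iY by (auto intro!: sub.real_cond_exp_mult)
  then show "AE x in M. real_cond_exp M (F s) (\<lambda>x. if x \<in> A then X t x else Y t x) x
      \<le> (if x \<in> A then X s x else Y s x)"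
    unfolding eq using sub.real_cond_exp_add[OF iX iY] le
    by eventually_elim (auto simp: indicator_def)
qed

lemma supermartingale_single:
  assumes "k \<le> n" "n \<le> k" "X k \<in> borel_measurable (F k)" "integrable M (X k)"
  shows "supermartingale M F k n X"
proof -
  interpret sub: sigma_finite_subalgebra M "F k"
    using assms sigma_finite_subalgebra_F by simp
  have "AE x in M. real_cond_exp M (F k) (X k) x \<le> X k x"
    using sub.real_cond_exp_F_meas[OF assms(4,3)] by eventually_elim simp
  then show ?thesis using assms by (simp add: supermartingale_def)
qed

lemma supermartingale_tail:
  "supermartingale M F k n X \<Longrightarrow> k \<le> j \<Longrightarrow> supermartingale M F j n X"
  by (simp add: supermartingale_def)

text \<open>Only pairs starting at time \<open>k\<close> are new. For a later \<open>t\<close>, the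
  tower property through \<open>F (Suc k)\<close> reduces the inequality to the one assumed for
  \<open>X (Suc k)\<close>.\<close>

lemma supermartingale_extend:
  assumes X: "supermartingale M F (Suc k) n X" and k: "Suc k \<le> n"
    and Y: "Y \<in> borel_measurable (F k)" "integrable M Y"
    and le: "AE x in M. real_cond_exp M (F k) (X (Suc k)) x \<le> Y x"
  shows "supermartingale M F k n (X(k := Y))"
  unfolding supermartingale_def
proof (intro conjI ballI)
  fix t assume t: "t \<in> {k..n}"
  show "(X(k := Y)) t \<in> borel_measurable (F t)" "integrable M ((X(k := Y)) t)"
    using X Y t by (auto simp: supermartingale_def)
next
  fix s t assume s: "s \<in> {k..n}" and t: "t \<in> {s..n}"
  interpret sub: sigma_finite_subalgebra M "F k"
    using k sigma_finite_subalgebra_F by simp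
  consider "s > k" | "s = k" "t = k" | "s = k" "t > k" using s t by force
  then show "AE x in M. real_cond_exp M (F s) ((X(k := Y)) t) x \<le> (X(k := Y)) s x"
  proof cases
    case 1
    then show ?thesis using X s t by (auto simp: supermartingale_def)
  next
    case 2
    then show ?thesis using sub.real_cond_exp_F_meas[OF Y(2,1)] by auto
  next
    case 3
    have int: "integrable M (X t)" "integrable M (X (Suc k))"
      and mart: "AE x in M. real_cond_exp M (F (Suc k)) (X t) x \<le> X (Suc k) x"
      using X 3 t k by (auto simp: supermartingale_def)
    interpret sub': sigma_finite_subalgebra M "F (Suc k)"
      using k sigma_finite_subalgebra_F by simp
    have "AE x in M. real_cond_exp M (F k) (real_cond_exp M (F (Suc k)) (X t)) x
        = real_cond_exp M (F k) (X t) x"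
      using subalg[OF k] filtration[of k "Suc k"] k int
      by (intro sub.real_cond_exp_nested_subalg) auto
    moreover have "AE x in M. real_cond_exp M (F k) (real_cond_exp M (F (Suc k)) (X t)) x
        \<le> real_cond_exp M (F k) (X (Suc k)) x"
      using sub.real_cond_exp_mono[OF mart sub'.real_cond_exp_int(1)[OF int(1)] int(2)] .
    ultimately show ?thesis using le 3 by (auto elim: eventually_elim2)
  qed
qed

text \<open>For later times \<open>t\<close>, the initial value occurs only as an upper bound, so
  increasing it preserves the inequalities. This is what allows a restart from a maximum.\<close>

lemma supermartingale_raise:
  assumes X: "supermartingale M F k n X" and k: "k \<le> n"
    and Y: "Y \<in> borel_measurable (F k)" "integrable M Y"
    and le: "AE x in M. X k x \<le> Y x"
  shows "supermartingale M F k n (X(k := Y))"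
proof (cases "k = n")
  case True
  then show ?thesis using Y by (intro supermartingale_single) auto
next
  case False
  then have "AE x in M. real_cond_exp M (F k) (X (Suc k)) x \<le> X k x"
    using X k by (simp add: supermartingale_def)
  then have "AE x in M. real_cond_exp M (F k) (X (Suc k)) x \<le> Y x"
    using le by eventually_elim simp
  then show ?thesis using supermartingale_tail[OF X, of "Suc k"] False k Y
    by (intro supermartingale_extend) auto
qed

text \<open>Every conditional expectation from time \<open>k\<close> on fixes \<open>c\<close>. The
  shift serves to turn an inequality for the conditional expectation of the second process into an
  equality.\<close>

lemma supermartingale_add:
  assumes X: "supermartingale M F k n X"
    and c: "c \<in> borel_measurable (F k)" "integrable M c"
  shows "supermartingale M F k n (\<lambda>t x. X t x + c x)"
  unfolding supermartingale_def
proof (intro conjI ballI)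
  fix t assume t: "t \<in> {k..n}"
  have [measurable]: "X t \<in> borel_measurable (F t)" "c \<in> borel_measurable (F t)"
    using X t measurable_later[OF _ _ c(1)] by (auto simp: supermartingale_def)
  show "(\<lambda>x. X t x + c x) \<in> borel_measurable (F t)" by measurable
  show "integrable M (\<lambda>x. X t x + c x)"
    using X t c by (auto simp: supermartingale_def)
next
  fix s t assume s: "s \<in> {k..n}" and t: "t \<in> {s..n}"
  interpret sub: sigma_finite_subalgebra M "F s"
    using s sigma_finite_subalgebra_F by simp
  have cF: "c \<in> borel_measurable (F s)" using s measurable_later[OF _ _ c(1)] by auto
  have int: "integrable M (X t)" and le: "AE x in M. real_cond_exp M (F s) (X t) x \<le> X s x"
    using X s t by (auto simp: supermartingale_def)
  show "AE x in M. real_cond_exp M (F s) (\<lambda>x. X t x + c x) x \<le> X s x + c x"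
    using sub.real_cond_exp_add[OF int c(2)] sub.real_cond_exp_F_meas[OF c(2) cF] le
    by eventually_elim simp
qed

end

section \<open>Admissible starting values\<close>

text \<open>As \<open>k < n\<close>, the maximum is over a nonempty set and splits into one
  inequality per time, a form that is convenient when processes are glued or changed at a single
  time.\<close>

lemma admissible_iff:
  assumes "k < n"
  shows "m \<in> admissible P Q F n l \<alpha> S k Nk Zk \<longleftrightarrow>
    m \<in> borel_measurable (F k) \<and>
    (\<exists>M N. supermartingale Q F k n M \<and> M k = m \<and> supermartingale P F k n N \<and> N k = Nk \<and>
      (AE x in P. Zk x \<le> ereal (N n x) \<and> (\<forall>t\<in>{k<..n}. l (M t x - S t x) - \<alpha> t \<le> N n x)))"
proof -
  have "{k<..n} = {k+1..n}" by auto
  then show ?thesis using assms by (simp add: admissible_def)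
qed

text \<open>Equivalence of the two measures is recorded as a rewrite rule that moves almost-sure
  statements between them.\<close>

locale equivalent_prob_filtration =
  P: prob_filtration P F n + Q: prob_filtration Q F n
  for P Q :: "'a measure" and F n +
  assumes AE_eq: "(AE x in Q. \<phi> x) \<longleftrightarrow> (AE x in P. \<phi> x)"
begin

lemma admissible_measurable:
  "k < n \<Longrightarrow> m \<in> admissible P Q F n l \<alpha> S k Nk Zk \<Longrightarrow> m \<in> borel_measurable (F k)"
  by (simp add: admissible_iff)

lemma admissible_integrable:
  "k < n \<Longrightarrow> m \<in> admissible P Q F n l \<alpha> S k Nk Zk \<Longrightarrow> integrable Q m"
  by (auto simp: admissible_iff supermartingale_def)

lemma is_ess_inf_value_function:
  assumes "k < n"
  shows "is_ess_inf P {\<lambda>x. ereal (m x) | m. m \<in> admissible P Q F n l \<alpha> S k Nk Zk}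
    (value_function P Q F n l \<alpha> S k Nk Zk)"
proof -
  have "{\<lambda>x. ereal (m x) | m. m \<in> admissible P Q F n l \<alpha> S k Nk Zk} \<subseteq> borel_measurable P"
    using P.measurable_M[OF less_imp_le[OF assms] admissible_measurable[OF assms]] by auto
  then show ?thesis
    using P.is_ess_inf_ess_inf assms by (simp add: value_function_def)
qed

lemma value_function_le:
  assumes "k < n" "m \<in> admissible P Q F n l \<alpha> S k Nk Zk"
  shows "AE x in P. value_function P Q F n l \<alpha> S k Nk Zk x \<le> ereal (m x)"
  by (rule is_ess_inf_lower[OF is_ess_inf_value_function[OF assms(1)]]) (use assms(2) in blast)

text \<open>Both processes of each pair are switched on the same set. The two second processes share
  the initial value \<open>Nk\<close>, so the glued one starts from \<open>Nk\<close> as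
  well.\<close>

lemma admissible_glue:
  assumes k: "k < n"
    and m: "m \<in> admissible P Q F n l \<alpha> S k Nk Zk" "m' \<in> admissible P Q F n l \<alpha> S k Nk Zk"
    and A: "A \<in> sets (F k)"
  shows "(\<lambda>x. if x \<in> A then m x else m' x) \<in> admissible P Q F n l \<alpha> S k Nk Zk"
proof -
  let ?con = "\<lambda>M N x. Zk x \<le> ereal (N n x) \<and> (\<forall>t\<in>{k<..n}. l (M t x - S t x) - \<alpha> t \<le> N n x)"
  obtain M N where MN: "supermartingale Q F k n M" "M k = m" "supermartingale P F k n N"
    "N k = Nk" "AE x in P. ?con M N x"
    using m(1) unfolding admissible_iff[OF k] by blast
  obtain M' N' where MN': "supermartingale Q F k n M'" "M' k = m'" "supermartingale P F k n N'"
    "N' k = Nk" "AE x in P. ?con M' N' x"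
    using m(2) unfolding admissible_iff[OF k] by blast
  let ?M = "\<lambda>t x. if x \<in> A then M t x else M' t x"
  let ?N = "\<lambda>t x. if x \<in> A then N t x else N' t x"
  have "AE x in P. ?con ?M ?N x"
    using MN(5) MN'(5) by eventually_elim auto
  moreover have "supermartingale Q F k n ?M" "supermartingale P F k n ?N"
    using MN MN' A by (auto intro: P.supermartingale_glue Q.supermartingale_glue)
  moreover have "?M k = (\<lambda>x. if x \<in> A then m x else m' x)" "?N k = Nk"
    using MN MN' by auto
  moreover have "(\<lambda>x. if x \<in> A then m x else m' x) \<in> borel_measurable (F k)"
    using m[THEN admissible_measurable[OF k]] A by measurable
  ultimately show ?thesis unfolding admissible_iff[OF k] by blast
qed

text \<open>The minimum of two admissible values is their gluing along the
  \<open>F k\<close>-measurable set where the first is the smaller; induction covers finitely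
  many.\<close>

lemma admissible_running_min:
  assumes k: "k < n" and f: "\<And>j. f j \<in> admissible P Q F n l \<alpha> S k Nk Zk"
  shows "\<exists>m. m \<in> admissible P Q F n l \<alpha> S k Nk Zk \<and> (\<forall>x\<in>space P. \<forall>i\<le>j::nat. m x \<le> f i x)"
proof (induction j)
  case 0
  show ?case using f[of 0] by (intro exI[of _ "f 0"]) auto
next
  case (Suc j)
  then obtain m where m: "m \<in> admissible P Q F n l \<alpha> S k Nk Zk"
    "\<And>x i. x \<in> space P \<Longrightarrow> i \<le> j \<Longrightarrow> m x \<le> f i x" by blast
  define A where "A = {x\<in>space (F k). m x \<le> f (Suc j) x}"
  have [measurable]: "m \<in> borel_measurable (F k)" "f (Suc j) \<in> borel_measurable (F k)"
    using admissible_measurable[OF k] m(1) f by blast+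
  have "A \<in> sets (F k)" unfolding A_def by measurable
  then have "(\<lambda>x. if x \<in> A then m x else f (Suc j) x) \<in> admissible P Q F n l \<alpha> S k Nk Zk"
    by (rule admissible_glue[OF k m(1) f])
  moreover have "(if x \<in> A then m x else f (Suc j) x) \<le> f i x"
    if x: "x \<in> space P" and i: "i \<le> Suc j" for x i
  proof -
    have "(if x \<in> A then m x else f (Suc j) x) = min (m x) (f (Suc j) x)"
      using x k P.space_F[of k] by (simp add: A_def)
    then show ?thesis using m(2)[OF x, of i] i by (cases "i = Suc j") auto
  qed
  ultimately show ?case by blast
qed

section \<open>From the one-step condition to a bound on the value function\<close>

text \<open>Starting at \<open>max m M\<close> instead of \<open>m\<close> keeps the supermartingale
  property because it is larger than \<open>m\<close>, and meets the constraint at time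
  \<open>Suc k\<close> because it is larger than \<open>M\<close>. Taking conditional expectations
  then prepends time \<open>k\<close>.\<close>

lemma admissible_restart:
  assumes k: "Suc k < n" and l: "antimono l"
    and m: "m \<in> admissible P Q F n l \<alpha> S (Suc k) N
      (\<lambda>y. max (Zk y) (ereal (l (M y - S (Suc k) y) - \<alpha> (Suc k))))"
    and M: "M \<in> borel_measurable (F (Suc k))" "integrable Q M"
    and N: "AE x in P. real_cond_exp P (F k) N x = Nk x"
    and Nk: "Nk \<in> borel_measurable (F k)" "integrable P Nk"
  shows "real_cond_exp Q (F k) (\<lambda>x. max (m x) (M x)) \<in> admissible P Q F n l \<alpha> S k Nk Zk"
proof -
  have kn: "k < n" "k \<le> n" "Suc k \<le> n" using k by auto
  obtain M' N' where MN: "supermartingale Q F (Suc k) n M'" "M' (Suc k) = m"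
    "supermartingale P F (Suc k) n N'" "N' (Suc k) = N"
    and con: "AE x in P. max (Zk x) (ereal (l (M x - S (Suc k) x) - \<alpha> (Suc k))) \<le> ereal (N' n x) \<and>
      (\<forall>t\<in>{Suc k<..n}. l (M' t x - S t x) - \<alpha> t \<le> N' n x)"
    using m unfolding admissible_iff[OF k] by blast
  let ?h = "\<lambda>x. max (m x) (M x)"
  let ?c = "real_cond_exp Q (F k) ?h"
  have h: "?h \<in> borel_measurable (F (Suc k))" "integrable Q ?h"
    using admissible_measurable[OF k m] admissible_integrable[OF k m] M by auto
  interpret sub: sigma_finite_subalgebra Q "F k"
    using kn Q.sigma_finite_subalgebra_F by simp
  have c: "?c \<in> borel_measurable (F k)" "integrable Q ?c"
    using h by auto
  let ?M = "(M'(Suc k := ?h))(k := ?c)" and ?N = "N'(k := Nk)"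
  have "supermartingale Q F (Suc k) n (M'(Suc k := ?h))"
    using MN h kn by (intro Q.supermartingale_raise) auto
  then have "supermartingale Q F k n ?M"
    by (rule Q.supermartingale_extend) (use c kn in auto)
  moreover have "supermartingale P F k n ?N"
    using MN N Nk kn by (intro P.supermartingale_extend) auto
  moreover have "AE x in P. Zk x \<le> ereal (?N n x) \<and> (\<forall>t\<in>{k<..n}. l (?M t x - S t x) - \<alpha> t \<le> ?N n x)"
    using con
  proof eventually_elim
    case (elim x)
    \<comment> \<open>The constraint at \<open>Suc k\<close> for \<open>M\<close> is already part of
      the second component of the pair, so monotonicity of \<open>l\<close> transfers it to the
      maximum.\<close>
    have "l (?h x - S (Suc k) x) \<le> l (M x - S (Suc k) x)"
      using l by (rule antimonoD) simp
    then have "l (?M t x - S t x) - \<alpha> t \<le> N' n x" if "t \<in> {k<..n}" for t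
      using elim that by (cases "t = Suc k") auto
    then show ?case using elim kn by auto
  qed
  ultimately show ?thesis unfolding admissible_iff[OF kn(1)]
    using c by (intro conjI exI[of _ ?M] exI[of _ ?N]) auto
qed

text \<open>The terminal case is separate because the value function at \<open>n\<close> is given by
  convention rather than as an essential infimum; here the processes have just two dates.\<close>

lemma admissible_last_step:
  assumes n: "n = Suc k"
    and M: "M \<in> borel_measurable (F (Suc k))" "integrable Q M"
    and N: "N \<in> borel_measurable (F (Suc k))" "integrable P N"
      "AE x in P. real_cond_exp P (F k) N x = Nk x"
    and Nk: "Nk \<in> borel_measurable (F k)" "integrable P Nk"
    and con: "AE x in P. max (Zk x) (ereal (l (M x - S (Suc k) x) - \<alpha> (Suc k))) \<le> ereal (N x)"
  shows "real_cond_exp Q (F k) M \<in> admissible P Q F n l \<alpha> S k Nk Zk"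
proof -
  have kn: "k < n" using n by simp
  interpret sub: sigma_finite_subalgebra Q "F k"
    using kn Q.sigma_finite_subalgebra_F by simp
  let ?c = "real_cond_exp Q (F k) M"
  have c: "?c \<in> borel_measurable (F k)" "integrable Q ?c" using M by auto
  let ?M = "(\<lambda>_. M)(k := ?c)" and ?N = "(\<lambda>_. N)(k := Nk)"
  have "supermartingale Q F k n ?M"
    using c M n by (intro Q.supermartingale_extend Q.supermartingale_single) auto
  moreover have "supermartingale P F k n ?N"
    using N Nk n by (intro P.supermartingale_extend P.supermartingale_single) auto
  moreover have "AE x in P. Zk x \<le> ereal (?N n x) \<and> (\<forall>t\<in>{k<..n}. l (?M t x - S t x) - \<alpha> t \<le> ?N n x)"
    using con
  proof eventually_elim
    case (elim x)
    have "{k<..n} = {Suc k}" using n by auto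
    then show ?case using elim n by auto
  qed
  ultimately show ?thesis unfolding admissible_iff[OF kn]
    using c by (intro conjI exI[of _ ?M] exI[of _ ?N]) auto
qed

text \<open>In general \<open>M\<close> dominates only an essential infimum of admissible values,
  not one of them. Hence the slack \<open>e\<close>, an approximating sequence, and a limit inside
  the conditional expectation.\<close>

lemma value_function_le_cond_exp:
  assumes k: "k < n" and l: "antimono l"
    and M: "M \<in> borel_measurable (F (Suc k))" "integrable Q M"
    and N: "N \<in> borel_measurable (F (Suc k))" "integrable P N"
      "AE x in P. real_cond_exp P (F k) N x = Nk x"
    and Nk: "Nk \<in> borel_measurable (F k)"
    and V: "AE x in P. value_function P Q F n l \<alpha> S (Suc k) N
      (\<lambda>y. max (Zk y) (ereal (l (M y - S (Suc k) y) - \<alpha> (Suc k)))) x \<le> ereal (M x)"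
  shows "AE x in P. value_function P Q F n l \<alpha> S k Nk Zk x \<le> ereal (real_cond_exp Q (F k) M x)"
proof -
  interpret subP: sigma_finite_subalgebra P "F k"
    using k P.sigma_finite_subalgebra_F by simp
  interpret subQ: sigma_finite_subalgebra Q "F k"
    using k Q.sigma_finite_subalgebra_F by simp
  \<comment> \<open>Integrability of \<open>Nk\<close> comes from its being almost surely the
    conditional expectation of the integrable \<open>N\<close>.\<close>
  have NkI: "integrable P Nk"
    using subP.real_cond_exp_int(1)[OF N(2)] N(3) P.measurable_M[OF _ Nk] k
    by (subst integrable_cong_AE[of _ _ "real_cond_exp P (F k) N"]) (auto elim: AE_symmetric)
  let ?Z = "\<lambda>y. max (Zk y) (ereal (l (M y - S (Suc k) y) - \<alpha> (Suc k)))"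
  show ?thesis
  proof (cases "Suc k = n")
    case True
    \<comment> \<open>At the horizon the value function is infinite of either sign; lying below the
      real number \<open>M x\<close> forces \<open>-\<infinity>\<close>, that is, the constraint
      itself.\<close>
    have "AE x in P. ?Z x \<le> ereal (N x)"
      using V by eventually_elim (auto simp: value_function_def True not_less simp del: max_less_iff_conj split: if_splits)
    then have "real_cond_exp Q (F k) M \<in> admissible P Q F n l \<alpha> S k Nk Zk"
      using True M N Nk NkI by (intro admissible_last_step) auto
    then show ?thesis by (rule value_function_le[OF k])
  next
    case False
    then have k': "Suc k < n" using k by simp
    let ?A = "admissible P Q F n l \<alpha> S (Suc k) N ?Z"
    let ?\<Phi> = "{\<lambda>x. ereal (m x) | m. m \<in> ?A}"
    have V': "AE x in P. ess_inf P ?\<Phi> x \<le> ereal (M x)"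
      using V k' by (simp add: value_function_def)
    have \<Phi>meas: "?\<Phi> \<subseteq> borel_measurable P"
      using P.measurable_M[OF less_imp_le[OF k'] admissible_measurable[OF k']] by auto
    \<comment> \<open>The essential infimum of the empty family is \<open>\<infinity>\<close>, which
      cannot lie below the real-valued \<open>M\<close>.\<close>
    have ne: "?\<Phi> \<noteq> {}"
    proof
      assume e: "?\<Phi> = {}"
      have "AE x in P. \<infinity> \<le> ess_inf P ?\<Phi> x"
        using P.is_ess_inf_ess_inf[OF \<Phi>meas] unfolding is_ess_inf_def e
        by (auto dest!: bspec[of _ _ "\<lambda>_. \<infinity>"])
      with V' have "AE x in P. False" by eventually_elim auto
      then show False by simp
    qed
    have MP [measurable]: "M \<in> borel_measurable P" using P.measurable_M[of "Suc k" M] M k by simp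
    have eps: "AE x in P. value_function P Q F n l \<alpha> S k Nk Zk x
        \<le> ereal (real_cond_exp Q (F k) M x + e)" if e: "e > 0" for e
    proof -
      \<comment> \<open>The slack \<open>e\<close> supplies the strict inequality that
        \<open>ess_inf_approx\<close> asks for.\<close>
      have "AE x in P. ess_inf P ?\<Phi> x < ereal (M x + e)"
        using V' by eventually_elim (use e in \<open>auto intro: le_less_trans\<close>)
      then obtain \<phi> where \<phi>: "range \<phi> \<subseteq> ?\<Phi>" "AE x in P. \<exists>j::nat. \<phi> j x \<le> ereal (M x + e)"
        using P.ess_inf_approx[OF \<Phi>meas ne, of "\<lambda>x. ereal (M x + e)"] by auto
      have "\<exists>m. \<phi> j = (\<lambda>x. ereal (m x)) \<and> m \<in> ?A" for j using \<phi>(1) by blast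
      then obtain f where f: "\<And>j. \<phi> j = (\<lambda>x. ereal (f j x))" "\<And>j. f j \<in> ?A" by metis
      \<comment> \<open>At almost every point some \<open>f i\<close> is below \<open>M + e\<close>;
        after passing to running minima, all later members are.\<close>
      have "\<forall>j. \<exists>m. m \<in> ?A \<and> (\<forall>x\<in>space P. \<forall>i\<le>j. m x \<le> f i x)"
        by (intro allI admissible_running_min[OF k']) (rule f(2))
      then have "\<exists>g. \<forall>j. g j \<in> ?A \<and> (\<forall>x\<in>space P. \<forall>i\<le>j. g j x \<le> f i x)"
        by (rule choice)
      then obtain g where "\<forall>j. g j \<in> ?A \<and> (\<forall>x\<in>space P. \<forall>i\<le>j. g j x \<le> f i x)" ..
      then have g: "\<And>j. g j \<in> ?A" "\<And>x i j. x \<in> space P \<Longrightarrow> i \<le> j \<Longrightarrow> g j x \<le> f i x"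
        by simp_all
      define h where "h = (\<lambda>j x. max (g j x) (M x))"
      \<comment> \<open>The excess of the restarted value over \<open>M + e\<close>. At almost every
        point it is eventually zero.\<close>
      define Y where "Y = (\<lambda>j x. max 0 (h j x - (M x + e)))"
      have gI: "integrable Q (g j)" and fI: "integrable Q (f j)" for j
        using admissible_integrable[OF k' g(1)] admissible_integrable[OF k' f(2)] .
      have hI: "integrable Q (h j)" for j unfolding h_def using gI M by auto
      have YI: "integrable Q (Y j)" for j unfolding Y_def using hI M by auto
      have "(\<lambda>j. \<integral>x. Y j x \<partial>Q) \<longlonglongrightarrow> (\<integral>x. 0 \<partial>Q)"
      \<comment> \<open>The dominating function works because every running minimum
        \<open>g j\<close> lies below \<open>f 0\<close>.\<close>
      proof (rule integral_dominated_convergence[where w = "\<lambda>x. max (f 0 x) (M x) - M x"])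
        show "integrable Q (\<lambda>x. max (f 0 x) (M x) - M x)" using fI M by auto
        have "AE x in P. (\<lambda>j. Y j x) \<longlonglongrightarrow> 0"
          using \<phi>(2) AE_space
        proof eventually_elim
          case (elim x)
          then obtain i where "f i x \<le> M x + e" by (auto simp: f)
          then have "g j x \<le> M x + e" if "j \<ge> i" for j using g(2)[of x i j] elim that by simp
          then have "eventually (\<lambda>j. Y j x = 0) sequentially"
            unfolding eventually_sequentially Y_def h_def using e by (intro exI[of _ i]) auto
          then show ?case by (rule tendsto_eventually)
        qed
        then show "AE x in Q. (\<lambda>j. Y j x) \<longlonglongrightarrow> 0" by (simp add: AE_eq)
        have "AE x in P. norm (Y j x) \<le> max (f 0 x) (M x) - M x" for j
          using AE_space
        proof eventually_elim
          case (elim x)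
          have "g j x \<le> f 0 x" using g(2)[of x 0 j] elim by simp
          then show ?case using e by (auto simp: Y_def h_def)
        qed
        then show "AE x in Q. norm (Y j x) \<le> max (f 0 x) (M x) - M x" for j by (simp add: AE_eq)
      qed (use YI in auto)
      then have "AE x in Q. \<forall>d>0. \<exists>j. real_cond_exp Q (F k) (Y j) x < d"
        using YI by (intro subQ.AE_real_cond_exp_arbitrarily_small) (auto simp: Y_def)
      then have small: "AE x in P. \<forall>d>0. \<exists>j. real_cond_exp Q (F k) (Y j) x < d"
        by (simp add: AE_eq)
      have "AE x in P. value_function P Q F n l \<alpha> S k Nk Zk x
          \<le> ereal (real_cond_exp Q (F k) M x + e + real_cond_exp Q (F k) (Y j) x)" for j
      proof -
        have cI: "integrable Q (\<lambda>x. M x + e)" using M by simp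
        have "AE x in Q. real_cond_exp Q (F k) (h j) x \<le> real_cond_exp Q (F k) (\<lambda>x. (M x + e) + Y j x) x"
          using hI YI cI by (intro subQ.real_cond_exp_mono) (auto simp: Y_def)
        moreover have "AE x in Q. real_cond_exp Q (F k) (\<lambda>x. (M x + e) + Y j x) x
            = real_cond_exp Q (F k) (\<lambda>x. M x + e) x + real_cond_exp Q (F k) (Y j) x"
          using YI cI by (intro subQ.real_cond_exp_add) auto
        moreover have "AE x in Q. real_cond_exp Q (F k) (\<lambda>x. M x + e) x
            = real_cond_exp Q (F k) M x + real_cond_exp Q (F k) (\<lambda>_. e) x"
          using M by (intro subQ.real_cond_exp_add) auto
        moreover have "AE x in Q. real_cond_exp Q (F k) (\<lambda>_. e) x = e"
          by (rule subQ.real_cond_exp_F_meas) auto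
        ultimately have "AE x in Q. real_cond_exp Q (F k) (h j) x
            \<le> real_cond_exp Q (F k) M x + e + real_cond_exp Q (F k) (Y j) x"
          by eventually_elim simp
        moreover have "real_cond_exp Q (F k) (h j) \<in> admissible P Q F n l \<alpha> S k Nk Zk"
          using admissible_restart[OF k' l g(1) M N(3) Nk NkI] unfolding h_def .
        then have "AE x in P. value_function P Q F n l \<alpha> S k Nk Zk x \<le> ereal (real_cond_exp Q (F k) (h j) x)"
          by (rule value_function_le[OF k])
        ultimately show ?thesis
          unfolding AE_eq by eventually_elim (auto intro: order_trans)
      qed
      \<comment> \<open>One null set serves all \<open>j\<close>, so at each remaining point the
        index making the last term small can be chosen depending on \<open>x\<close>.\<close>
      then have "AE x in P. \<forall>j. value_function P Q F n l \<alpha> S k Nk Zk x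
          \<le> ereal (real_cond_exp Q (F k) M x + e + real_cond_exp Q (F k) (Y j) x)"
        by (simp add: AE_all_countable)
      then show ?thesis using small
      proof eventually_elim
        case (elim x)
        show ?case
        proof (rule ereal_le_epsilon2)
          fix d :: real assume "d > 0"
          then obtain j where "real_cond_exp Q (F k) (Y j) x < d" using elim by blast
          then show "value_function P Q F n l \<alpha> S k Nk Zk x
              \<le> ereal (real_cond_exp Q (F k) M x + e) + ereal d"
            using elim(1)[rule_format, of j] by (auto intro: order_trans)
        qed
      qed
    qed
    \<comment> \<open>The null set in \<open>eps\<close> depends on \<open>e\<close>; countably many
      values \<open>1 / Suc i\<close> suffice for the limit.\<close>
    have "AE x in P. \<forall>i. value_function P Q F n l \<alpha> S k Nk Zk x
        \<le> ereal (real_cond_exp Q (F k) M x + 1 / Suc i)"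
      unfolding AE_all_countable by (intro allI eps) simp
    then show ?thesis
    proof eventually_elim
      case (elim x)
      show ?case
      proof (rule ereal_le_epsilon2)
        fix d :: real assume "d > 0"
        then obtain i where "1 / Suc i < d" using nat_approx_posE by blast
        then show "value_function P Q F n l \<alpha> S k Nk Zk x
            \<le> ereal (real_cond_exp Q (F k) M x) + ereal d"
          using elim[rule_format, of i] by (auto intro: order_trans)
      qed
    qed
  qed
qed

section \<open>From an admissible value to the one-step condition\<close>

lemma admissible_one_step:
  assumes k: "k < n" and m: "m \<in> admissible P Q F n l \<alpha> S k Nk Zk"
  shows "\<exists>M N. M \<in> borel_measurable (F (Suc k)) \<and> integrable Q M \<and>
    N \<in> borel_measurable (F (Suc k)) \<and> integrable P N \<and>
    (AE x in P. real_cond_exp P (F k) N x = Nk x) \<and>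
    (AE x in P. value_function P Q F n l \<alpha> S (Suc k) N
      (\<lambda>y. max (Zk y) (ereal (l (M y - S (Suc k) y) - \<alpha> (Suc k)))) x \<le> ereal (M x)) \<and>
    (AE x in P. real_cond_exp Q (F k) M x \<le> m x)"
proof -
  obtain M N where MN: "supermartingale Q F k n M" "M k = m" "supermartingale P F k n N"
    "N k = Nk"
    and con: "AE x in P. Zk x \<le> ereal (N n x) \<and> (\<forall>t\<in>{k<..n}. l (M t x - S t x) - \<alpha> t \<le> N n x)"
    using m unfolding admissible_iff[OF k] by blast
  interpret sub: sigma_finite_subalgebra P "F k"
    using k P.sigma_finite_subalgebra_F by simp
  have M: "M (Suc k) \<in> borel_measurable (F (Suc k))" "integrable Q (M (Suc k))"
    "AE x in Q. real_cond_exp Q (F k) (M (Suc k)) x \<le> m x"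
    using MN(1,2) k by (auto simp: supermartingale_def)
  have N: "integrable P (N (Suc k))" "Nk \<in> borel_measurable (F k)" "integrable P Nk"
    "AE x in P. real_cond_exp P (F k) (N (Suc k)) x \<le> Nk x"
    using MN(3,4) k by (auto simp: supermartingale_def)
  \<comment> \<open>The gap in the supermartingale inequality from \<open>k\<close> to
    \<open>Suc k\<close>: almost surely nonnegative, \<open>F k\<close>-measurable, and exactly what
    has to be added to the second process.\<close>
  define c where "c = (\<lambda>x. Nk x - real_cond_exp P (F k) (N (Suc k)) x)"
  have c: "c \<in> borel_measurable (F k)" "integrable P c" "AE x in P. 0 \<le> c x"
    unfolding c_def using N by auto
  define N' where "N' = (\<lambda>t x. N t x + c x)"
  have N': "supermartingale P F (Suc k) n N'"
    unfolding N'_def using k P.measurable_later[of k "Suc k" c] c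
    by (intro P.supermartingale_add[OF P.supermartingale_tail[OF MN(3)]]) simp_all
  have "AE x in P. real_cond_exp P (F k) (N' (Suc k)) x = Nk x"
    unfolding N'_def using sub.real_cond_exp_add[OF N(1) c(2)] sub.real_cond_exp_F_meas[OF c(2,1)]
    by eventually_elim (simp add: c_def)
  let ?Z = "\<lambda>y. max (Zk y) (ereal (l (M (Suc k) y - S (Suc k) y) - \<alpha> (Suc k)))"
  \<comment> \<open>Adding \<open>c\<close> only relaxes the constraints, and the one at time
    \<open>Suc k\<close> moves into \<open>?Z\<close>.\<close>
  have con': "AE x in P. ?Z x \<le> ereal (N' n x) \<and>
      (\<forall>t\<in>{Suc k<..n}. l (M t x - S t x) - \<alpha> t \<le> N' n x)"
    using con c(3)
  proof eventually_elim
    case (elim x)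
    have "Zk x \<le> ereal (N' n x)"
      using elim by (auto simp: N'_def intro: order_trans)
    moreover have "l (M t x - S t x) - \<alpha> t \<le> N' n x" if "t \<in> {k<..n}" for t
      using elim that by (force simp: N'_def)
    ultimately show ?case using k by auto
  qed
  have "AE x in P. value_function P Q F n l \<alpha> S (Suc k) (N' (Suc k)) ?Z x \<le> ereal (M (Suc k) x)"
  proof (cases "Suc k = n")
    case True
    \<comment> \<open>At the horizon \<open>con'\<close> selects the value
      \<open>-\<infinity>\<close> of the convention.\<close>
    show ?thesis using con'
      by eventually_elim (use True in \<open>simp add: value_function_def leD del: max_less_iff_conj\<close>)
  next
    case False
    then have k': "Suc k < n" using k by simp
    have "M (Suc k) \<in> admissible P Q F n l \<alpha> S (Suc k) (N' (Suc k)) ?Z"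
      unfolding admissible_iff[OF k'] using M(1) Q.supermartingale_tail[OF MN(1)] N' con'
      by (intro conjI exI[of _ M] exI[of _ N']) auto
    then show ?thesis by (rule value_function_le[OF k'])
  qed
  moreover have "N' (Suc k) \<in> borel_measurable (F (Suc k))" "integrable P (N' (Suc k))"
    using N' k by (auto simp: supermartingale_def)
  ultimately show ?thesis using M \<open>AE x in P. real_cond_exp P (F k) (N' (Suc k)) x = Nk x\<close>
    unfolding AE_eq by blast
qed

end

section \<open>The dynamic programming principle\<close>

theorem proposition10:
  fixes P Q :: "'a measure"
    and F :: "nat \<Rightarrow> 'a measure"
    and n k :: nat
    and p :: "nat \<Rightarrow> 'a \<Rightarrow> real"
    and S :: "nat \<Rightarrow> 'a \<Rightarrow> real"
    and l :: "real \<Rightarrow> real"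
    and \<alpha> :: "nat \<Rightarrow> real"
    and Nk :: "'a \<Rightarrow> real"
    and Zk :: "'a \<Rightarrow> ereal"
  assumes "prob_space P"
    and "prob_space Q"
    and "sets Q = sets P"
    and "absolutely_continuous P Q"
    and "absolutely_continuous Q P"
    and "n \<ge> 1"
    and "\<And>i. i \<le> n \<Longrightarrow> subalgebra P (F i)"
    and "\<And>i j. i \<le> j \<Longrightarrow> j \<le> n \<Longrightarrow> subalgebra (F j) (F i)"
    and "\<And>A. A \<in> sets (F 0) \<Longrightarrow> measure P A = 0 \<or> measure P A = 1"
    and "\<And>i. 1 \<le> i \<Longrightarrow> i \<le> n \<Longrightarrow> p i \<in> borel_measurable (F i)"
    and "\<And>i. 1 \<le> i \<Longrightarrow> i \<le> n \<Longrightarrow> integrable Q (p i)"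
    and "S = partial_sum p"
    and "convex_on UNIV l"
    and "antimono l"
    and "bdd_below (range l)"
    and "k < n"
    and "Nk \<in> borel_measurable (F k)"
    and "Zk \<in> borel_measurable (F k)"
    and "\<And>x. x \<in> space P \<Longrightarrow> Zk x \<noteq> \<infinity>"
  shows "AE x in P. value_function P Q F n l \<alpha> S k Nk Zk x =
    ess_inf P {\<lambda>x. ereal (real_cond_exp Q (F k) M x) | M.
      M \<in> borel_measurable (F (k+1)) \<and> integrable Q M \<and>
      (\<exists>N. N \<in> borel_measurable (F (k+1)) \<and> integrable P N \<and>
        (AE x in P. real_cond_exp P (F k) N x = Nk x) \<and>
        (AE x in P. ereal (M x) \<ge>
           value_function P Q F n l \<alpha> S (k+1) N
             (\<lambda>y. max (Zk y) (ereal (l (M y - S (k+1) y) - \<alpha> (k+1)))) x))} x"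
proof -
  interpret P: prob_space P by fact
  interpret Q: prob_space Q by fact
  have subQ: "subalgebra Q (F i)" if "i \<le> n" for i
    using assms(7)[OF that] assms(3) sets_eq_imp_space_eq[OF assms(3)] by (simp add: subalgebra_def)
  interpret equivalent_prob_filtration P Q F n
  proof unfold_locales
    show "(AE x in Q. \<phi> x) \<longleftrightarrow> (AE x in P. \<phi> x)" for \<phi>
      using absolutely_continuous_AE[OF assms(3,4)] absolutely_continuous_AE[OF assms(3)[symmetric] assms(5)]
      by blast
  qed (use assms subQ in auto)
  let ?V = "value_function P Q F n l \<alpha> S k Nk Zk"
  let ?\<Psi> = "{\<lambda>x. ereal (real_cond_exp Q (F k) M x) | M.
      M \<in> borel_measurable (F (k+1)) \<and> integrable Q M \<and>
      (\<exists>N. N \<in> borel_measurable (F (k+1)) \<and> integrable P N \<and>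
        (AE x in P. real_cond_exp P (F k) N x = Nk x) \<and>
        (AE x in P. ereal (M x) \<ge>
           value_function P Q F n l \<alpha> S (k+1) N
             (\<lambda>y. max (Zk y) (ereal (l (M y - S (k+1) y) - \<alpha> (k+1)))) x))}"
  \<comment> \<open>\<open>ess_inf\<close> is defined by choice; measurability of the family
    guarantees that an essential infimum exists to be chosen.\<close>
  have meas: "?\<Psi> \<subseteq> borel_measurable P"
    using P.measurable_M[OF less_imp_le[OF \<open>k < n\<close>] borel_measurable_cond_exp] by auto
  have R: "is_ess_inf P ?\<Psi> (ess_inf P ?\<Psi>)"
    using meas by (rule P.is_ess_inf_ess_inf)
  have L: "is_ess_inf P {\<lambda>x. ereal (m x) | m. m \<in> admissible P Q F n l \<alpha> S k Nk Zk} ?V"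
    by (rule is_ess_inf_value_function[OF \<open>k < n\<close>])
  \<comment> \<open>Each side is the greatest lower bound of its own family, so it is enough that it
    bounds the other family from below.\<close>
  have "AE x in P. ?V x \<le> \<psi> x" if \<psi>: "\<psi> \<in> ?\<Psi>" for \<psi>
    using \<psi> unfolding mem_Collect_eq Suc_eq_plus1[symmetric]
  proof (elim exE conjE)
    fix M N :: "'a \<Rightarrow> real"
    assume *: "M \<in> borel_measurable (F (Suc k))" "integrable Q M"
      "N \<in> borel_measurable (F (Suc k))" "integrable P N"
      "AE x in P. real_cond_exp P (F k) N x = Nk x"
    assume **: "AE x in P. value_function P Q F n l \<alpha> S (Suc k) N
        (\<lambda>y. max (Zk y) (ereal (l (M y - S (Suc k) y) - \<alpha> (Suc k)))) x \<le> ereal (M x)"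
    assume \<psi>: "\<psi> = (\<lambda>x. ereal (real_cond_exp Q (F k) M x))"
    show ?thesis
      unfolding \<psi> by (rule value_function_le_cond_exp[OF \<open>k < n\<close> \<open>antimono l\<close> * \<open>Nk \<in> borel_measurable (F k)\<close> **])
  qed
  then have "AE x in P. ?V x \<le> ess_inf P ?\<Psi> x"
    by (rule is_ess_inf_greatest[OF R is_ess_inf_measurable[OF L]])
  moreover have "AE x in P. ess_inf P ?\<Psi> x \<le> ereal (m x)"
    if m: "m \<in> admissible P Q F n l \<alpha> S k Nk Zk" for m
  proof -
    obtain M N where MN: "M \<in> borel_measurable (F (Suc k))" "integrable Q M"
      "N \<in> borel_measurable (F (Suc k))" "integrable P N"
      "AE x in P. real_cond_exp P (F k) N x = Nk x"
      "AE x in P. value_function P Q F n l \<alpha> S (Suc k) N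
        (\<lambda>y. max (Zk y) (ereal (l (M y - S (Suc k) y) - \<alpha> (Suc k)))) x \<le> ereal (M x)"
      and le: "AE x in P. real_cond_exp Q (F k) M x \<le> m x"
      using admissible_one_step[OF \<open>k < n\<close> m] by blast
    have "(\<lambda>x. ereal (real_cond_exp Q (F k) M x)) \<in> ?\<Psi>"
      unfolding mem_Collect_eq Suc_eq_plus1[symmetric]
      by (intro exI[of _ M] exI[of _ N] conjI refl MN)
    then have "AE x in P. ess_inf P ?\<Psi> x \<le> ereal (real_cond_exp Q (F k) M x)"
      by (rule is_ess_inf_lower[OF R])
    then show ?thesis using le by eventually_elim (auto intro: order_trans)
  qed
  then have "AE x in P. ess_inf P ?\<Psi> x \<le> ?V x"
    by (intro is_ess_inf_greatest[OF L is_ess_inf_measurable[OF R]]) blast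
  ultimately show ?thesis by eventually_elim (rule antisym)
qed

end
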